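(* Let $n,m\geq1$. Let $\mathcal{D}_{\mathrm{train}}$ be a training sample independent of $(X_i,Y_i)_{i\in\{1,\dots,n+m\}}$, where the latter are i.i.d. from a distribution $P$ on $\mathbb{R}^d\times\mathbb{R}$; $\mathcal{D}_{\mathrm{cal}}=\{(X_i,Y_i):i\leq n\}$ is the calibration sample and $\mathcal{D}_{\mathrm{test}}=\{(X_{n+i},Y_{n+i}):i\leq m\}$ the test sample. Let $\hat\mu(x)=\hat\mu(x;(\mathcal{D}_{\mathrm{train}},X_1,\dots,X_{n+m}))$ be a predictor such that for all $x\in\mathbb{R}^d$, $\hat\mu(x;\cdot)$ is invariant under permutation of $(X_1,\dots,X_{n+m})$. Let $S_i=|Y_i-\hat\mu(X_i)|$, $i\in\{1,\dots,n+m\}$, and assume these scores have almost surely no ties. Let $S_{(1)}\leq\dots\leq S_{(n)}$ be the ordered calibration scores, $S_{(n+1)}:=+\infty$, and for $\alpha\in(0,1)$ let $\mathcal{C}_i(\alpha)=\big[\hat\mu(X_{n+i})-S_{(\lceil(n+1)(1-\alpha)\rceil)},\,\hat\mu(X_{n+i})+S_{(\lceil(n+1)(1-\alpha)\rceil)}\big]$, $i\in\{1,\dots,m\}$, and $\mathrm{FCP}(\boldsymbol{\mathcal{C}}(\alpha))=m^{-1}\sum_{i=1}^m\mathbf{1}\{Y_{n+i}\notin\mathcal{C}_i(\alpha)\}$. Then: (i) for any $\bar\alpha\in[0,1]$ and $\delta\in(0,1)$, if $t_{\bar\alpha,\delta}$ satisfies $\mathbb{P}_{\boldsymbol{p}\sim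 P_{n,m}}\big(p_{(\lfloor\bar\alpha m\rfloor+1)}\leq t_{\bar\alpha,\delta}\big)\leq\delta$, then $\mathbb{P}\big(\mathrm{FCP}(\boldsymbol{\mathcal{C}}(t_{\bar\alpha,\delta}))\leq\bar\alpha\big)\geq1-\delta$; (ii) for any $\delta\in(0,1)$, if $(\overline{\mathrm{FCP}}_{\alpha,\delta})_{\alpha\in(0,1)}$ is a family of bounds, each a measurable function of the conformal $p$-value vector, such that $\mathbb{P}_{\boldsymbol{p}\sim P_{n,m}}\big(\exists\alpha\in(0,1):\widehat{F}_m(\alpha)>\overline{\mathrm{FCP}}_{\alpha,\delta}\big)\leq\delta$, then $\mathbb{P}\big(\forall\alpha\in(0,1):\mathrm{FCP}(\boldsymbol{\mathcal{C}}(\alpha))\leq\overline{\mathrm{FCP}}_{\alpha,\delta}\big)\geq1-\delta$.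
   Context: Conformal $p$-values: $p_i=\frac{1}{n+1}\big(1+\sum_{j=1}^n\mathbf{1}\{S_j\geq S_{n+i}\}\big)$, $i\in\{1,\dots,m\}$; $p_{(1)}\leq\dots\leq p_{(m)}$ are their order statistics, with the convention $p_{(m+1)}=+\infty$; $\widehat{F}_m(t)=m^{-1}\sum_{i=1}^m\mathbf{1}\{p_i\leq t\}$. For $\boldsymbol p\sim P_{n,m}$ the same notation is used for the order statistics and empirical c.d.f. of $\boldsymbol p$. $P^U$: for $U\in[0,1]^n$ with order statistics $U_{(1)}\leq\dots\leq U_{(n)}$, $U_{(0)}=0$, $U_{(n+1)}=1$, the distribution on $\{\ell/(n+1):\ell\leq n+1\}$ with mass $U_{(\ell)}-U_{(\ell-1)}$ at $\ell/(n+1)$. $P_{n,m}$: distribution of $(q_1,\dots,q_m)$ where $U_1,\dots,U_n$ i.i.d. $\mathrm{Unif}[0,1]$ and, given $U$, $q_1,\dots,q_m$ i.i.d. $\sim P^U$. *)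

theory Defs
  imports "HOL-Probability.Probability"
begin

text \<open>Order statistics of U = (U 0, ..., U (n-1)) in [0,1]^n with the conventions
  U_(0) = 0 and U_(n+1) = 1 (indices here are the paper's, i.e. 1-based).\<close>
definition U_ord :: "nat \<Rightarrow> (nat \<Rightarrow> real) \<Rightarrow> nat \<Rightarrow> real" where
  "U_ord n U l = (if l = 0 then 0 else if l \<le> n then sort (map U [0..<n]) ! (l - 1) else 1)"

definition PU :: "nat \<Rightarrow> (nat \<Rightarrow> real) \<Rightarrow> real pmf" where
  "PU n U = embed_pmf (\<lambda>x. \<Sum>l\<in>{1..n+1}.
       (if x = real l / real (n + 1) then U_ord n U l - U_ord n U (l - 1) else 0))"

definition Pnm_prob :: "nat \<Rightarrow> nat \<Rightarrow> (nat \<Rightarrow> real) set \<Rightarrow> ennreal" where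
  "Pnm_prob n m A =
     (\<integral>\<^sup>+ U. ennreal (measure_pmf.prob (Pi_pmf {..<m} undefined (\<lambda>_. PU n U)) A)
        \<partial>(PiM {..<n} (\<lambda>_. uniform_measure lborel {0..1::real})))"

text \<open>k-th order statistic (1-based) of p = (p 0, ..., p (m-1)), with p_(m+1) = +infinity.\<close>
definition p_ord :: "nat \<Rightarrow> (nat \<Rightarrow> real) \<Rightarrow> nat \<Rightarrow> ereal" where
  "p_ord m p k = (if 1 \<le> k \<and> k \<le> m then ereal (sort (map p [0..<m]) ! (k - 1)) else \<infinity>)"

definition F_hat :: "nat \<Rightarrow> (nat \<Rightarrow> real) \<Rightarrow> real \<Rightarrow> real" where
  "F_hat m p t = real (card {i\<in>{..<m}. p i \<le> t}) / real m"

text \<open>Indices are 0-based: calibration points 0..n-1, test points n..n+m-1.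
  The fitted predictor at x is mu (T \<omega>) (X_0..X_{n+m-1}) x, where T is the training sample.\<close>
definition mu_hat :: "('w \<Rightarrow> 't) \<Rightarrow> (nat \<Rightarrow> 'w \<Rightarrow> 'x) \<Rightarrow> ('t \<Rightarrow> (nat \<Rightarrow> 'x) \<Rightarrow> 'x \<Rightarrow> real)
    \<Rightarrow> nat \<Rightarrow> 'w \<Rightarrow> 'x \<Rightarrow> real" where
  "mu_hat T X mu N \<omega> x = mu (T \<omega>) (restrict (\<lambda>j. X j \<omega>) {..<N}) x"

definition score :: "('w \<Rightarrow> 't) \<Rightarrow> (nat \<Rightarrow> 'w \<Rightarrow> 'x) \<Rightarrow> (nat \<Rightarrow> 'w \<Rightarrow> real)
    \<Rightarrow> ('t \<Rightarrow> (nat \<Rightarrow> 'x) \<Rightarrow> 'x \<Rightarrow> real) \<Rightarrow> nat \<Rightarrow> nat \<Rightarrow> 'w \<Rightarrow> real" where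
  "score T X Y mu N i \<omega> = \<bar>Y i \<omega> - mu_hat T X mu N \<omega> (X i \<omega>)\<bar>"

text \<open>S_(k) of the calibration scores S 0..S (n-1), with k = ceil((n+1)(1-alpha)),
  S_(n+1) = +infinity (and, for k <= 0, which only happens when alpha >= 1, -infinity).\<close>
definition cal_quantile :: "nat \<Rightarrow> (nat \<Rightarrow> real) \<Rightarrow> real \<Rightarrow> ereal" where
  "cal_quantile n S \<alpha> =
     (let k = \<lceil>real (n + 1) * (1 - \<alpha>)\<rceil> in
      if k > int n then \<infinity>
      else if k < 1 then - \<infinity>
      else ereal (sort (map S [0..<n]) ! (nat k - 1)))"

definition in_interval :: "real \<Rightarrow> ereal \<Rightarrow> real \<Rightarrow> bool" where
  "in_interval c q y \<longleftrightarrow> ereal c - q \<le> ereal y \<and> ereal y \<le> ereal c + q"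

definition FCP :: "('w \<Rightarrow> 't) \<Rightarrow> (nat \<Rightarrow> 'w \<Rightarrow> 'x) \<Rightarrow> (nat \<Rightarrow> 'w \<Rightarrow> real)
    \<Rightarrow> ('t \<Rightarrow> (nat \<Rightarrow> 'x) \<Rightarrow> 'x \<Rightarrow> real) \<Rightarrow> nat \<Rightarrow> nat \<Rightarrow> real \<Rightarrow> 'w \<Rightarrow> real" where
  "FCP T X Y mu n m \<alpha> \<omega> =
     (\<Sum>i<m. if in_interval (mu_hat T X mu (n + m) \<omega> (X (n + i) \<omega>))
                  (cal_quantile n (\<lambda>j. score T X Y mu (n + m) j \<omega>) \<alpha>) (Y (n + i) \<omega>)
             then 0 else 1) / real m"

definition conf_pvals :: "('w \<Rightarrow> 't) \<Rightarrow> (nat \<Rightarrow> 'w \<Rightarrow> 'x) \<Rightarrow> (nat \<Rightarrow> 'w \<Rightarrow> real)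
    \<Rightarrow> ('t \<Rightarrow> (nat \<Rightarrow> 'x) \<Rightarrow> 'x \<Rightarrow> real) \<Rightarrow> nat \<Rightarrow> nat \<Rightarrow> 'w \<Rightarrow> nat \<Rightarrow> real" where
  "conf_pvals T X Y mu n m \<omega> = (\<lambda>i\<in>{..<m}.
      (1 + real (card {j\<in>{..<n}. score T X Y mu (n + m) j \<omega> \<ge> score T X Y mu (n + m) (n + i) \<omega>}))
      / real (n + 1))"

end

theory Submission
  imports Defs
begin

text \<open>The false coverage proportion at level \<open>\<alpha>\<close> is exactly the empirical c.d.f. of the conformal
  p-values at \<open>\<alpha>\<close>, so both claims reduce to identifying the law of the p-value vector. This vector
  depends only on the ranks of the \<open>n + m\<close> scores. The scores are exchangeable, because the predictor is
  a symmetric function of the covariates, and they have no ties; averaging over all permutations shows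
  that the p-values fall in \<open>A\<close> with probability \<open>#{\<pi>. p-values of \<pi> \<in> A} / (n + m)!\<close>, whatever the
  law of the scores. For the scores \<open>- U\<close>, with \<open>U\<close> i.i.d. uniform on \<open>[0,1]\<close>, conditioning on
  the first \<open>n\<close> coordinates gives precisely \<open>P\<^bsub>n,m\<^esub>\<close>.\<close>

section \<open>The p-value vector as a function of the scores\<close>

text \<open>Leaving the vector \<open>undefined\<close> outside \<open>{..<m}\<close> matches the
  default value in \<open>Pi_pmf {..<m} undefined\<close>, so both kinds of vector can be compared
  as functions.\<close>

definition conf_p :: "nat \<Rightarrow> nat \<Rightarrow> (nat \<Rightarrow> real) \<Rightarrow> nat \<Rightarrow> real" where
  "conf_p n m S =
     (\<lambda>i\<in>{..<m}. (1 + real (card {j\<in>{..<n}. S j \<ge> S (n + i)})) / real (n + 1))"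

definition conf_p_range :: "nat \<Rightarrow> nat \<Rightarrow> (nat \<Rightarrow> real) set" where
  "conf_p_range n m = {..<m} \<rightarrow>\<^sub>E (\<lambda>k. (1 + real k) / real (n + 1)) ` {..n}"

lemma finite_conf_p_range [simp]: "finite (conf_p_range n m)"
  by (auto simp: conf_p_range_def intro!: finite_PiE)

lemma card_Collect_lessThan_le: "card {j\<in>{..<n}. P j} \<le> n"
  using card_mono[of "{..<n}" "{j\<in>{..<n}. P j}"] by auto

lemma conf_p_in_range: "conf_p n m S \<in> conf_p_range n m"
  unfolding conf_p_def conf_p_range_def by (intro PiE_I) (auto intro!: imageI card_Collect_lessThan_le[simplified])

lemma conf_p_eq_iff:
  assumes "v \<in> conf_p_range n m"
  shows "conf_p n m S = v \<longleftrightarrow>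
    (\<forall>i<m. (1 + real (card {j\<in>{..<n}. S j \<ge> S (n + i)})) / real (n + 1) = v i)"
  using assms by (auto simp: conf_p_def conf_p_range_def fun_eq_iff PiE_def extensional_def)

text \<open>Serves two purposes: replacing scores by their ranks, and ignoring the values of a score
  function at indices from \<open>n + m\<close> on.\<close>

lemma conf_p_cong:
  assumes "\<And>i j. i < n + m \<Longrightarrow> j < n + m \<Longrightarrow> S i \<le> S j \<longleftrightarrow> S' i \<le> S' j"
  shows "conf_p n m S = conf_p n m S'"
proof -
  have "{j\<in>{..<n}. S j \<ge> S (n + i)} = {j\<in>{..<n}. S' j \<ge> S' (n + i)}" if "i < m" for i
    using assms that by auto
  then show ?thesis by (auto simp: conf_p_def restrict_def fun_eq_iff)
qed

lemma measurable_card_Collect_lessThan [measurable (raw)]: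
  fixes n :: nat
  assumes "\<And>j. j < n \<Longrightarrow> Measurable.pred M (P j)"
  shows "(\<lambda>x. real (card {j\<in>{..<n}. P j x})) \<in> borel_measurable M"
proof -
  have "real (card {j\<in>{..<n}. P j x}) = (\<Sum>j<n. if P j x then 1 else 0)" for x
    by (subst sum.inter_filter[symmetric]) simp_all
  then show ?thesis using assms by simp
qed

lemma measurable_conf_p:
  assumes [measurable]: "\<And>i. i < n + m \<Longrightarrow> (\<lambda>x. S x i) \<in> borel_measurable M"
  shows "(\<lambda>x. conf_p n m (S x)) \<in> measurable M (count_space (conf_p_range n m))"
proof (subst measurable_count_space_eq2, simp, intro conjI ballI)
  show "(\<lambda>x. conf_p n m (S x)) \<in> space M \<rightarrow> conf_p_range n m"
    by (auto intro: conf_p_in_range)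
  fix v assume v: "v \<in> conf_p_range n m"
  have "(\<lambda>x. conf_p n m (S x)) -` {v} \<inter> space M = {x\<in>space M. \<forall>i\<in>{..<m}.
      (1 + real (card {j\<in>{..<n}. S x j \<ge> S x (n + i)})) / real (n + 1) = v i}"
    by (simp add: vimage_def Int_def conf_p_eq_iff[OF v] conj_commute Ball_def)
  also have "\<dots> \<in> sets M"
    by measurable
  finally show "(\<lambda>x. conf_p n m (S x)) -` {v} \<inter> space M \<in> sets M" .
qed

text \<open>The set \<open>A\<close> is arbitrary: only its intersection with the finite set
  \<open>conf_p_range n m\<close> matters, and every subset of that is measurable in the counting
  space.\<close>

lemma sets_conf_p:
  assumes "\<And>i. i < n + m \<Longrightarrow> (\<lambda>x. S x i) \<in> borel_measurable M"
  shows "{x\<in>space M. conf_p n m (S x) \<in> A} \<in> sets M"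
proof -
  have "{x\<in>space M. conf_p n m (S x) \<in> A} =
      (\<lambda>x. conf_p n m (S x)) -` (A \<inter> conf_p_range n m) \<inter> space M"
    using conf_p_in_range by auto
  also have "\<dots> \<in> sets M"
    by (rule measurable_sets[OF measurable_conf_p[OF assms]]) auto
  finally show ?thesis .
qed

section \<open>Ranks, permutations and exchangeability\<close>

text \<open>Each index is sent to its rank, the number of strictly smaller entries. The rank is
  below \<open>N\<close> because an index does not count itself, and ranks are distinct because
  there are no ties; an injective map of a finite set into itself is a bijection.\<close>

lemma ex_rank_permutation:
  fixes x :: "nat \<Rightarrow> real"
  assumes inj: "inj_on x {..<N}"
  obtains r where "r permutes {..<N}"
    "\<And>i j. i < N \<Longrightarrow> j < N \<Longrightarrow> x i \<le> x j \<longleftrightarrow> r i \<le> r j"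
proof
  define c where "c i = card {k\<in>{..<N}. x k < x i}" for i
  \<comment> \<open>Beyond \<open>N\<close> the map is the identity, as \<open>permutes\<close>
    demands.\<close>
  define r where "r i = (if i < N then c i else i)" for i
  have less: "c i < c j" if "x i < x j" "i < N" for i j
    unfolding c_def using that by (intro psubset_card_mono) auto
  have mono: "x i \<le> x j \<longleftrightarrow> c i \<le> c j" if "i < N" "j < N" for i j
  proof
    assume "x i \<le> x j"
    then show "c i \<le> c j"
      unfolding c_def by (intro card_mono) auto
  qed (use less that in \<open>force simp: not_less[symmetric]\<close>)
  then show "x i \<le> x j \<longleftrightarrow> r i \<le> r j" if "i < N" "j < N" for i j
    using that by (simp add: r_def)
  have "c i < N" if "i < N" for i
  proof -
    have "{k\<in>{..<N}. x k < x i} \<subset> {..<N}" using that by auto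
    from psubset_card_mono[OF _ this] show ?thesis by (simp add: c_def)
  qed
  then have sub: "r ` {..<N} \<subseteq> {..<N}" by (auto simp: r_def)
  have "inj_on r {..<N}"
  proof (rule inj_onI)
    fix i j assume "i \<in> {..<N}" "j \<in> {..<N}" "r i = r j"
    then have "x i = x j" using mono[of i j] mono[of j i] by (auto simp: r_def)
    then show "i = j" using inj \<open>i \<in> {..<N}\<close> \<open>j \<in> {..<N}\<close> by (auto dest: inj_onD)
  qed
  then have "bij_betw r {..<N} {..<N}"
    using sub by (simp add: bij_betw_def endo_inj_surj)
  then show "r permutes {..<N}"
    by (rule bij_imp_permutes) (simp add: r_def)
qed

text \<open>The law-free quantity through which the two models are compared: divided by
  \<open>(n + m)!\<close> it is the probability of \<open>A\<close> under a uniformly random ranking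
  of the scores.\<close>

definition conf_p_count :: "nat \<Rightarrow> nat \<Rightarrow> (nat \<Rightarrow> real) set \<Rightarrow> nat" where
  "conf_p_count n m A = card {\<pi>. \<pi> permutes {..<n + m} \<and> conf_p n m (real \<circ> \<pi>) \<in> A}"

text \<open>Only the ranks of the scores matter, and the ranks of \<open>x \<circ> \<pi>\<close> are those of \<open>x\<close> composed
  with \<open>\<pi>\<close>; hence the count does not depend on \<open>x\<close>.\<close>

lemma card_permutations_conf_p:
  assumes inj: "inj_on x {..<n + m}"
  shows "card {\<pi>. \<pi> permutes {..<n + m} \<and> conf_p n m (x \<circ> \<pi>) \<in> A} = conf_p_count n m A"
proof -
  obtain r where r: "r permutes {..<n + m}"
    "\<And>i j. i < n + m \<Longrightarrow> j < n + m \<Longrightarrow> x i \<le> x j \<longleftrightarrow> r i \<le> r j"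
    using ex_rank_permutation[OF inj] by blast
  have eq: "conf_p n m (x \<circ> \<pi>) = conf_p n m (real \<circ> (r \<circ> \<pi>))" if "\<pi> permutes {..<n + m}" for \<pi>
    using permutes_in_image[OF that] by (intro conf_p_cong) (simp add: r(2))
  have "bij_betw ((\<circ>) r) {\<pi>. \<pi> permutes {..<n + m} \<and> conf_p n m (x \<circ> \<pi>) \<in> A}
      {\<pi>. \<pi> permutes {..<n + m} \<and> conf_p n m (real \<circ> \<pi>) \<in> A}"
  proof (rule bij_betw_byWitness[where f' = "(\<circ>) (inv r)"])
    show "(\<circ>) r ` {\<pi>. \<pi> permutes {..<n + m} \<and> conf_p n m (x \<circ> \<pi>) \<in> A}
      \<subseteq> {\<pi>. \<pi> permutes {..<n + m} \<and> conf_p n m (real \<circ> \<pi>) \<in> A}"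
      using permutes_compose[OF _ r(1)] eq by auto
    have "r \<circ> (inv r \<circ> \<pi>) = \<pi>" for \<pi> :: "nat \<Rightarrow> nat"
      by (simp add: o_assoc permutes_inv_o[OF r(1)])
    then show "(\<circ>) (inv r) ` {\<pi>. \<pi> permutes {..<n + m} \<and> conf_p n m (real \<circ> \<pi>) \<in> A}
      \<subseteq> {\<pi>. \<pi> permutes {..<n + m} \<and> conf_p n m (x \<circ> \<pi>) \<in> A}"
      using permutes_compose[OF _ permutes_inv[OF r(1)]] by (auto simp: eq simp del: comp_apply)
  qed (simp_all add: o_assoc permutes_inv_o[OF r(1)])
  then show ?thesis
    unfolding conf_p_count_def by (rule bij_betw_same_card)
qed

text \<open>By \<open>exch\<close> all \<open>(n + m)!\<close> rearrangements give the event the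
  same probability. Their sum is the expected number of permutations that bring the p-values into
  \<open>A\<close>, and without ties this number is the constant
  \<open>conf_p_count n m A\<close>.\<close>

lemma (in prob_space) prob_conf_p_exchangeable:
  assumes meas: "\<And>i. i < n + m \<Longrightarrow> (\<lambda>\<omega>. S \<omega> i) \<in> borel_measurable M"
    and exch: "\<And>\<pi>. \<pi> permutes {..<n + m} \<Longrightarrow>
      prob {\<omega>\<in>space M. conf_p n m (S \<omega> \<circ> \<pi>) \<in> A} = prob {\<omega>\<in>space M. conf_p n m (S \<omega>) \<in> A}"
    and inj: "AE \<omega> in M. inj_on (S \<omega>) {..<n + m}"
  shows "prob {\<omega>\<in>space M. conf_p n m (S \<omega>) \<in> A} = real (conf_p_count n m A) / fact (n + m)"
proof -
  let ?Perm = "{\<pi>. \<pi> permutes {..<n + m}}"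
  let ?E = "\<lambda>\<pi>. {\<omega>\<in>space M. conf_p n m (S \<omega> \<circ> \<pi>) \<in> A}"
  have fin: "finite ?Perm" by (simp add: finite_permutations)
  have E: "?E \<pi> \<in> events" if "\<pi> permutes {..<n + m}" for \<pi>
    using permutes_in_image[OF that] by (intro sets_conf_p) (simp add: meas)
  have "fact (n + m) * prob {\<omega>\<in>space M. conf_p n m (S \<omega>) \<in> A} = (\<Sum>\<pi>\<in>?Perm. prob (?E \<pi>))"
    by (simp add: exch card_permutations)
  also have "\<dots> = (\<Sum>\<pi>\<in>?Perm. expectation (indicator (?E \<pi>)))"
    using E by (intro sum.cong) auto
  also have "\<dots> = expectation (\<lambda>\<omega>. \<Sum>\<pi>\<in>?Perm. indicator (?E \<pi>) \<omega>)"
    using E by (intro Bochner_Integration.integral_sum[symmetric]) (auto simp: emeasure_eq_measure)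
  also have "\<dots> = expectation (\<lambda>\<omega>. real (conf_p_count n m A))"
  proof (rule integral_cong_AE)
    show "AE \<omega> in M. (\<Sum>\<pi>\<in>?Perm. indicator (?E \<pi>) \<omega>) = real (conf_p_count n m A)"
      using inj AE_space
    proof eventually_elim
      fix \<omega> assume "inj_on (S \<omega>) {..<n + m}" and \<omega>: "\<omega> \<in> space M"
      have "(\<Sum>\<pi>\<in>?Perm. indicator (?E \<pi>) \<omega>) =
          real (card {\<pi>. \<pi> permutes {..<n + m} \<and> conf_p n m (S \<omega> \<circ> \<pi>) \<in> A})"
        using fin \<omega> by (simp add: indicator_def sum.If_cases Int_def)
      also have "\<dots> = real (conf_p_count n m A)"
        using card_permutations_conf_p[OF \<open>inj_on (S \<omega>) {..<n + m}\<close>] by simp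
      finally show "(\<Sum>\<pi>\<in>?Perm. indicator (?E \<pi>) \<omega>) = real (conf_p_count n m A)" .
    qed
  qed (use E in auto)
  also have "\<dots> = real (conf_p_count n m A)"
    by (simp add: prob_space)
  finally show ?thesis
    by (simp add: field_simps)
qed

section \<open>Order statistics, counts and the false coverage proportion\<close>

text \<open>In the sorted list the entries satisfying a downward closed \<open>P\<close> form an
  initial segment. A general \<open>P\<close> covers both the weak and the strict inequality, which
  are each needed later.\<close>

lemma sort_nth_iff_card:
  fixes f :: "nat \<Rightarrow> real"
  assumes P: "\<And>x y. x \<le> y \<Longrightarrow> P y \<Longrightarrow> P x" and k: "1 \<le> k" "k \<le> n"
  shows "P (sort (map f [0..<n]) ! (k - 1)) \<longleftrightarrow> k \<le> card {j\<in>{..<n}. P (f j)}"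
proof -
  let ?s = "sort (map f [0..<n])"
  have "card {j\<in>{..<n}. P (f j)} = length (filter P (map f [0..<n]))"
    by (subst length_filter_conv_card) (auto intro!: arg_cong[where f=card])
  also have "\<dots> = length (filter P ?s)"
    by (metis filter_sort length_sort)
  also have "\<dots> = card {i. i < n \<and> P (?s ! i)}"
    by (simp add: length_filter_conv_card)
  finally have c: "card {j\<in>{..<n}. P (f j)} = card {i. i < n \<and> P (?s ! i)}" .
  have le: "?s ! i \<le> ?s ! j" if "i \<le> j" "j < n" for i j
    using that by (intro sorted_nth_mono) auto
  show ?thesis
  proof (cases "P (?s ! (k - 1))")
    case True
    have "{..<k} \<subseteq> {i. i < n \<and> P (?s ! i)}"
      using k True P[OF le[of _ "k - 1"]] by auto
    from card_mono[OF _ this] True c show ?thesis by auto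
  next
    case False
    have "{i. i < n \<and> P (?s ! i)} \<subseteq> {..<k - 1}"
      using k False P[OF le[of "k - 1"]] by (auto simp: not_less[symmetric])
    from card_mono[OF _ this] False c k show ?thesis by auto
  qed
qed

text \<open>The bounds on \<open>y\<close> fit the two conventions: \<open>U_(0) = 0\<close> never
  exceeds \<open>y\<close>, as the count is at least 0, and \<open>U_(n+1) = 1\<close> always does,
  as the count is at most \<open>n\<close>.\<close>

lemma U_ord_le_iff:
  assumes "0 \<le> y" "y < 1" "l \<le> n + 1"
  shows "U_ord n U l \<le> y \<longleftrightarrow> l \<le> card {j\<in>{..<n}. U j \<le> y}"
proof (cases "l = 0 \<or> l = n + 1")
  case True
  then show ?thesis using assms card_Collect_lessThan_le[of n "\<lambda>j. U j \<le> y"]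
    by (auto simp: U_ord_def)
next
  case False
  then show ?thesis
    using assms sort_nth_iff_card[of "\<lambda>x. x \<le> y" l n U] by (auto simp: U_ord_def)
qed

lemma U_ord_mono:
  assumes "\<forall>j<n. 0 \<le> U j \<and> U j \<le> 1"
  shows "0 \<le> U_ord n U l" "U_ord n U l \<le> 1" "U_ord n U l \<le> U_ord n U (Suc l)"
proof -
  let ?s = "sort (map U [0..<n])"
  have s: "0 \<le> ?s ! i \<and> ?s ! i \<le> 1" if "i < n" for i
  proof -
    have "?s ! i \<in> set ?s" using that by (intro nth_mem) simp
    then show ?thesis using assms by auto
  qed
  show "0 \<le> U_ord n U l" "U_ord n U l \<le> 1"
    using s by (auto simp: U_ord_def)
  show "U_ord n U l \<le> U_ord n U (Suc l)"
    using s by (auto simp: U_ord_def intro!: sorted_nth_mono)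
qed

text \<open>A test point is missed iff its score exceeds the k-th calibration score, iff at least
  \<open>k\<close> calibration scores lie strictly below it, iff its p-value is at most \<alpha>.
  The identity is pointwise and for every real \<alpha>, since the threshold in the first claim is
  an arbitrary real.\<close>

lemma FCP_eq_F_hat:
  "FCP T X Y mu n m \<alpha> \<omega> = F_hat m (conf_pvals T X Y mu n m \<omega>) \<alpha>"
proof -
  let ?S = "\<lambda>j. score T X Y mu (n + m) j \<omega>"
  have "in_interval (mu_hat T X mu (n + m) \<omega> (X (n + i) \<omega>)) (cal_quantile n ?S \<alpha>) (Y (n + i) \<omega>)
      \<longleftrightarrow> \<not> conf_pvals T X Y mu n m \<omega> i \<le> \<alpha>" if "i < m" for i
  proof -
    define s where "s = ?S (n + i)"
    \<comment> \<open>The p-value counts the scores at or above \<open>s\<close>; with the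
      complementary count \<open>c\<close> it equals \<open>(n + 1 - c) / (n + 1)\<close>, and
      comparing it with \<alpha> becomes the ceiling inequality \<open>k \<le> c\<close>.\<close>
    define c where "c = card {j\<in>{..<n}. ?S j < s}"
    define k where "k = \<lceil>real (n + 1) * (1 - \<alpha>)\<rceil>"
    have cn: "c \<le> n" unfolding c_def by (rule card_Collect_lessThan_le)
    have "{..<n} = {j\<in>{..<n}. ?S j < s} \<union> {j\<in>{..<n}. ?S j \<ge> s}" by auto
    then have "card {..<n} = card ({j\<in>{..<n}. ?S j < s} \<union> {j\<in>{..<n}. ?S j \<ge> s})" by (rule arg_cong)
    also have "\<dots> = c + card {j\<in>{..<n}. ?S j \<ge> s}"
      unfolding c_def by (rule card_Un_disjoint) auto
    finally have "real (card {j\<in>{..<n}. ?S j \<ge> s}) = real n - real c" by simp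
    then have "conf_pvals T X Y mu n m \<omega> i = (1 + (real n - real c)) / real (n + 1)"
      using that by (simp add: conf_pvals_def s_def)
    then have "conf_pvals T X Y mu n m \<omega> i \<le> \<alpha> \<longleftrightarrow> 1 + (real n - real c) \<le> \<alpha> * real (n + 1)"
      by (simp add: pos_divide_le_eq)
    also have "\<dots> \<longleftrightarrow> real (n + 1) * (1 - \<alpha>) \<le> real c"
      by (auto simp: algebra_simps)
    also have "\<dots> \<longleftrightarrow> k \<le> int c"
      unfolding k_def by (simp add: ceiling_le_iff)
    finally have p: "conf_pvals T X Y mu n m \<omega> i \<le> \<alpha> \<longleftrightarrow> k \<le> int c" .
    have q: "cal_quantile n ?S \<alpha> = (if k > int n then \<infinity> else if k < 1 then - \<infinity>
        else ereal (sort (map ?S [0..<n]) ! (nat k - 1)))"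
      unfolding cal_quantile_def Let_def k_def ..
    have s: "s = \<bar>Y (n + i) \<omega> - mu_hat T X mu (n + m) \<omega> (X (n + i) \<omega>)\<bar>"
      by (simp add: s_def score_def)
    \<comment> \<open>For \<open>k > n\<close> the interval is the whole line and
      \<open>c \<le> n < k\<close>; for \<open>k < 1\<close> it is empty and
      \<open>k \<le> 0 \<le> c\<close>. Only the middle case involves a true order
      statistic.\<close>
    consider "k > int n" | "k < 1" | "1 \<le> k" "k \<le> int n" by linarith
    then show ?thesis
    proof cases
      case 3
      have "sort (map ?S [0..<n]) ! (nat k - 1) < s \<longleftrightarrow> nat k \<le> c"
        unfolding c_def using 3 by (intro sort_nth_iff_card) auto
      with 3 show ?thesis unfolding p
        by (auto simp: q in_interval_def s)
    qed (use cn in \<open>auto simp: p q in_interval_def\<close>)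
  qed
  then show ?thesis
    unfolding FCP_def F_hat_def by (simp add: sum.If_cases Int_def)
qed

text \<open>The index is the least integer above \<open>a * m\<close>, so having that many p-values
  at most \<open>t\<close> means that their proportion exceeds \<open>a\<close>. For
  \<open>a = 1\<close> the index is \<open>m + 1\<close>: the order statistic is infinite, the
  proportion is at most 1, and both sides fail.\<close>

lemma p_ord_le_iff:
  assumes "0 \<le> a" "a \<le> 1" "1 \<le> m"
  shows "p_ord m p (nat \<lfloor>a * real m\<rfloor> + 1) \<le> ereal t \<longleftrightarrow> \<not> F_hat m p t \<le> a"
proof -
  define k where "k = nat \<lfloor>a * real m\<rfloor> + 1"
  define c where "c = card {i\<in>{..<m}. p i \<le> t}"
  have cm: "c \<le> m" unfolding c_def by (rule card_Collect_lessThan_le)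
  have "F_hat m p t \<le> a \<longleftrightarrow> real c \<le> a * real m"
    using assms by (simp add: F_hat_def c_def field_simps)
  also have "\<dots> \<longleftrightarrow> int c \<le> \<lfloor>a * real m\<rfloor>"
    by (simp add: le_floor_iff)
  also have "\<dots> \<longleftrightarrow> \<not> k \<le> c"
  proof -
    have "0 \<le> \<lfloor>a * real m\<rfloor>" using assms by simp
    then show ?thesis unfolding k_def by linarith
  qed
  finally have F: "F_hat m p t \<le> a \<longleftrightarrow> \<not> k \<le> c" .
  show ?thesis
  proof (cases "k \<le> m")
    case True
    have "sort (map p [0..<m]) ! (k - 1) \<le> t \<longleftrightarrow> k \<le> c"
      unfolding c_def using True by (intro sort_nth_iff_card) (auto simp: k_def)
    then show ?thesis
      using True F by (simp add: p_ord_def k_def)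
  qed (use cm F in \<open>simp add: p_ord_def k_def\<close>)
qed

section \<open>The uniform model and its conditional law given the calibration variables\<close>

abbreviation unif :: "real measure" where
  "unif \<equiv> uniform_measure lborel {0..1}"

lemma prob_space_unif: "prob_space unif"
  by (rule prob_space_uniform_measure) auto

lemma AE_PiM_unif: "AE U in PiM {..<n} (\<lambda>_. unif). \<forall>j<n. 0 \<le> U j \<and> U j \<le> 1"
  for n :: nat
proof -
  have "AE y in unif. 0 \<le> y \<and> y \<le> 1"
    by (rule AE_uniform_measureI) auto
  then have "AE U in PiM {..<n} (\<lambda>_. unif). 0 \<le> U j \<and> U j \<le> 1" if "j < n" for j
    using that by (intro AE_PiM_component) (auto intro: prob_space_unif)
  then have "AE U in PiM {..<n} (\<lambda>_. unif). \<forall>j\<in>{..<n}. 0 \<le> U j \<and> U j \<le> 1"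
    by (intro AE_finite_allI) auto
  then show ?thesis by (simp add: Ball_def)
qed

text \<open>For each of the finitely many pairs of indices, coordinate \<open>i\<close> is
  integrated first with the others fixed; the section of the tie event is then the single point
  \<open>x j\<close>, a Lebesgue null set.\<close>

lemma AE_PiM_unif_inj_on: "AE x in PiM {..<N} (\<lambda>_. unif). inj_on x {..<N}"
  for N :: nat
proof -
  interpret product_sigma_finite "\<lambda>_::nat. unif"
    by (intro product_sigma_finite.intro prob_space_imp_sigma_finite prob_space_unif)
  have "AE x in PiM {..<N} (\<lambda>_. unif). x i \<noteq> x j" if ij: "i < N" "j < N" "i \<noteq> j" for i j
  proof -
    let ?I = "{..<N} - {i}"
    have I: "{..<N} = insert i ?I" using ij by auto
    have [measurable]: "(\<lambda>x. x i) \<in> borel_measurable (PiM (insert i ?I) (\<lambda>_. unif))"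
      "(\<lambda>x. x j) \<in> borel_measurable (PiM (insert i ?I) (\<lambda>_. unif))"
      using ij measurable_component_singleton[of _ "insert i ?I" "\<lambda>_. unif"]
      by (auto simp: measurable_def)
    define E where "E = {x\<in>space (PiM (insert i ?I) (\<lambda>_. unif)). x i = x j}"
    have E[measurable]: "E \<in> sets (PiM (insert i ?I) (\<lambda>_. unif))"
      unfolding E_def by measurable
    have "emeasure (PiM (insert i ?I) (\<lambda>_. unif)) E =
        (\<integral>\<^sup>+x. indicator E x \<partial>PiM (insert i ?I) (\<lambda>_. unif))"
      using E by simp
    also have "\<dots> = (\<integral>\<^sup>+x. (\<integral>\<^sup>+y. indicator E (x(i := y)) \<partial>unif) \<partial>PiM ?I (\<lambda>_. unif))"
      using E by (intro product_nn_integral_insert borel_measurable_indicator) auto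
    also have "\<dots> \<le> (\<integral>\<^sup>+x. (\<integral>\<^sup>+y. indicator {x j} y \<partial>unif) \<partial>PiM ?I (\<lambda>_. unif))"
      using ij by (intro nn_integral_mono) (auto simp: E_def indicator_def)
    also have "\<dots> = 0"
    proof -
      have "{0..1} \<inter> {a} \<in> null_sets lborel" for a :: real
        by (rule null_set_Int1) (auto simp: null_sets_def)
      then show ?thesis by (simp add: null_sets_def)
    qed
    finally have "emeasure (PiM (insert i ?I) (\<lambda>_. unif)) E = 0" by simp
    then have "AE x in PiM (insert i ?I) (\<lambda>_. unif). x i \<noteq> x j"
      using E by (intro AE_I'[of E]) (auto simp: E_def)
    then show ?thesis unfolding I[symmetric] .
  qed
  then have "AE x in PiM {..<N} (\<lambda>_. unif). \<forall>i\<in>{..<N}. \<forall>j\<in>{..<N}. i \<noteq> j \<longrightarrow> x i \<noteq> x j"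
    by (intro AE_finite_allI) auto
  then show ?thesis
    by eventually_elim (auto simp: inj_on_def)
qed

text \<open>\<open>embed_pmf\<close> returns the given masses only if they are nonnegative and sum
  to 1. The first holds as the order statistics increase, the second as the increments telescope
  from 0 to 1. The index is shifted to \<open>k = l - 1\<close>, the count appearing in a
  p-value.\<close>

lemma pmf_PU:
  assumes U: "\<forall>j<n. 0 \<le> U j \<and> U j \<le> 1"
  shows "pmf (PU n U) x =
    (\<Sum>k\<le>n. if x = (1 + real k) / real (n + 1) then U_ord n U (Suc k) - U_ord n U k else 0)"
proof -
  let ?f = "\<lambda>x. \<Sum>k\<le>n. if x = (1 + real k) / real (n + 1) then U_ord n U (Suc k) - U_ord n U k else 0"
  have d: "0 \<le> U_ord n U (Suc k) - U_ord n U k" for k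
    using U_ord_mono(3)[OF U] by simp
  have "PU n U = embed_pmf ?f"
    unfolding PU_def
    by (simp add: sum.shift_bounds_cl_Suc_ivl atMost_atLeast0 cong: if_cong del: sum.cl_ivl_Suc)
  moreover have "(\<integral>\<^sup>+x. ennreal (?f x) \<partial>count_space UNIV) = 1"
  proof -
    have "(\<integral>\<^sup>+x. ennreal (?f x) \<partial>count_space UNIV) =
       (\<integral>\<^sup>+x. (\<Sum>k\<le>n. ennreal (U_ord n U (Suc k) - U_ord n U k) *
           indicator {(1 + real k) / real (n + 1)} x) \<partial>count_space UNIV)"
    proof (rule nn_integral_cong)
      fix x
      have "ennreal (?f x) = (\<Sum>k\<le>n. ennreal (if x = (1 + real k) / real (n + 1)
          then U_ord n U (Suc k) - U_ord n U k else 0))"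
        using d by (intro sum_ennreal[symmetric]) auto
      also have "\<dots> = (\<Sum>k\<le>n. ennreal (U_ord n U (Suc k) - U_ord n U k) *
          indicator {(1 + real k) / real (n + 1)} x)"
        by (intro sum.cong refl) simp
      finally show "ennreal (?f x) = \<dots>" .
    qed
    also have "\<dots> = (\<Sum>k\<le>n. ennreal (U_ord n U (Suc k) - U_ord n U k))"
      by (subst nn_integral_sum) (simp_all add: nn_integral_cmult_indicator)
    also have "\<dots> = ennreal (\<Sum>k\<le>n. U_ord n U (Suc k) - U_ord n U k)"
      using d by (simp add: sum_ennreal)
    also have "(\<Sum>k\<le>n. U_ord n U (Suc k) - U_ord n U k) = U_ord n U (Suc n) - U_ord n U 0"
      using sum_lessThan_telescope[of "U_ord n U" "Suc n"] by (simp add: lessThan_Suc_atMost)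
    finally show ?thesis by (simp add: U_ord_def)
  qed
  ultimately show ?thesis
    using d by (simp add: pmf_embed_pmf sum_nonneg)
qed

text \<open>The conditional law of a single p-value: for \<open>y\<close> in \<open>[0,1)\<close>,
  exactly \<open>k\<close> of the \<open>U j\<close> lie at or below \<open>y\<close> iff
  \<open>y\<close> is in \<open>[U_(k), U_(k+1))\<close>, and the length of this interval is the
  mass that \<open>PU n U\<close> gives to the corresponding atom.\<close>

lemma emeasure_unif_rank:
  assumes U: "\<forall>j<n. 0 \<le> U j \<and> U j \<le> 1"
    and x: "x \<in> (\<lambda>k. (1 + real k) / real (n + 1)) ` {..n}"
  shows "emeasure unif {y. (1 + real (card {j\<in>{..<n}. U j \<le> y})) / real (n + 1) = x} = pmf (PU n U) x"
proof -
  obtain k where k: "k \<le> n" "x = (1 + real k) / real (n + 1)" using x by auto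
  have iff: "(1 + real l) / real (n + 1) = x \<longleftrightarrow> l = k" for l
    unfolding k by (simp add: divide_cancel_right)
  let ?B = "{y. (1 + real (card {j\<in>{..<n}. U j \<le> y})) / real (n + 1) = x}"
  have B: "?B \<in> sets borel"
    using measurable_sets_borel[of "\<lambda>y. (1 + real (card {j\<in>{..<n}. U j \<le> y})) / real (n + 1)" borel "{x}"]
    by (simp add: vimage_def)
  \<comment> \<open>The point 1 must be discarded: its count is \<open>n\<close>, yet it is not in
    the half-open interval ending at \<open>U_(n+1) = 1\<close>.\<close>
  have "AE y in lborel. y \<noteq> (1::real)" by (rule AE_lborel_singleton)
  then have "AE y in lborel. y \<in> {0..1} \<inter> ?B \<longleftrightarrow> y \<in> {U_ord n U k..<U_ord n U (Suc k)}"
  proof eventually_elim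
    fix y :: real assume "y \<noteq> 1"
    show "y \<in> {0..1} \<inter> ?B \<longleftrightarrow> y \<in> {U_ord n U k..<U_ord n U (Suc k)}"
    proof (cases "0 \<le> y \<and> y < 1")
      case True
      then have "y \<in> {U_ord n U k..<U_ord n U (Suc k)} \<longleftrightarrow> card {j\<in>{..<n}. U j \<le> y} = k"
        using k U_ord_le_iff[of y k n U] U_ord_le_iff[of y "Suc k" n U] by auto
      with True show ?thesis unfolding Int_iff mem_Collect_eq iff by simp
    next
      case False
      then show ?thesis
        using \<open>y \<noteq> 1\<close> U_ord_mono(1)[OF U, of k] U_ord_mono(2)[OF U, of "Suc k"] by auto
    qed
  qed
  then have "emeasure lborel ({0..1} \<inter> ?B) = emeasure lborel {U_ord n U k..<U_ord n U (Suc k)}"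
    using B by (intro emeasure_eq_AE) auto
  also have "\<dots> = ennreal (U_ord n U (Suc k) - U_ord n U k)"
    using U_ord_mono(3)[OF U, of k] by simp
  also have "U_ord n U (Suc k) - U_ord n U k = pmf (PU n U) x"
    unfolding pmf_PU[OF U] eq_commute[of x] iff using k(1) by (simp add: sum.delta)
  finally show ?thesis
    using B by (simp add: divide_ennreal_def)
qed

lemma set_pmf_PU:
  assumes U: "\<forall>j<n. 0 \<le> U j \<and> U j \<le> 1"
  shows "set_pmf (PU n U) \<subseteq> (\<lambda>k. (1 + real k) / real (n + 1)) ` {..n}"
proof
  fix x assume "x \<in> set_pmf (PU n U)"
  then have "pmf (PU n U) x \<noteq> 0" by (simp add: set_pmf_iff)
  then obtain k where "k \<in> {..n}"
    "(if x = (1 + real k) / real (n + 1) then U_ord n U (Suc k) - U_ord n U k else 0) \<noteq> 0"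
    unfolding pmf_PU[OF U] by (rule sum.not_neutral_contains_not_neutral)
  then show "x \<in> (\<lambda>k. (1 + real k) / real (n + 1)) ` {..n}"
    by (auto split: if_splits)
qed

text \<open>With the calibration variables fixed at \<open>U\<close>, the p-values depend on
  separate independent coordinates. Each single vector therefore has a product probability on both
  sides, and \<open>A\<close> is, up to a null part, a finite disjoint union of such
  vectors.\<close>

lemma Pi_pmf_PU_eq_emeasure:
  assumes U: "\<forall>j<n. 0 \<le> U j \<and> U j \<le> 1"
  shows "ennreal (measure_pmf.prob (Pi_pmf {..<m} undefined (\<lambda>_. PU n U)) A) =
    emeasure (PiM {n..<n + m} (\<lambda>_. unif))
      {V\<in>space (PiM {n..<n + m} (\<lambda>_. unif)).
        conf_p n m (\<lambda>i. - merge {..<n} {n..<n + m} (U, V) i) \<in> A}"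
proof -
  interpret product_sigma_finite "\<lambda>_::nat. unif"
    by (intro product_sigma_finite.intro prob_space_imp_sigma_finite prob_space_unif)
  let ?J = "{n..<n + m}" let ?Q = "PiM {n..<n + m} (\<lambda>_. unif)"
  let ?p = "Pi_pmf {..<m} undefined (\<lambda>_. PU n U)"
  let ?E = "\<lambda>A. {V\<in>space ?Q. conf_p n m (\<lambda>i. - merge {..<n} ?J (U, V) i) \<in> A}"
  let ?R = "conf_p_range n m"
  have E: "?E A \<in> sets ?Q" for A
  proof (rule sets_conf_p)
    fix i assume i: "i < n + m"
    show "(\<lambda>V. - merge {..<n} ?J (U, V) i) \<in> borel_measurable ?Q"
      using i by (cases "i < n") (auto simp: merge_def)
  qed
  have single: "emeasure ?Q (?E {v}) = ennreal (pmf ?p v)" if v: "v \<in> ?R" for v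
  proof -
    let ?B = "\<lambda>i. {y. (1 + real (card {j\<in>{..<n}. U j \<le> y})) / real (n + 1) = v i}"
    have B: "?B i \<in> sets borel" for i
      using measurable_sets_borel[of "\<lambda>y. (1 + real (card {j\<in>{..<n}. U j \<le> y})) / real (n + 1)" borel "{v i}"]
      by (simp add: vimage_def)
    \<comment> \<open>After negation, p-value \<open>i\<close> counts the \<open>U j\<close> at or
      below \<open>V (n + i)\<close>. It constrains that one coordinate only, so the event is a
      box.\<close>
    have "?E {v} = Pi\<^sub>E ?J (\<lambda>i. ?B (i - n))"
    proof -
      have "{j\<in>{..<n}. - merge {..<n} ?J (U, V) (n + i) \<le> - merge {..<n} ?J (U, V) j}
          = {j\<in>{..<n}. U j \<le> V (n + i)}" if "i < m" for i V
        using that by (auto simp: merge_def)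
      then have "conf_p n m (\<lambda>i. - merge {..<n} ?J (U, V) i) = v \<longleftrightarrow> (\<forall>i<m. V (n + i) \<in> ?B i)" for V
        unfolding conf_p_eq_iff[OF v] by simp
      moreover have "(\<forall>i<m. V (n + i) \<in> ?B i) \<longleftrightarrow> (\<forall>i\<in>?J. V i \<in> ?B (i - n))" for V
      proof (intro iffI ballI allI impI)
        fix i assume *: "\<forall>i<m. V (n + i) \<in> ?B i" "i \<in> ?J"
        then show "V i \<in> ?B (i - n)"
          using *(1)[rule_format, of "i - n"] by auto
      next
        fix i assume *: "\<forall>i\<in>?J. V i \<in> ?B (i - n)" "i < m"
        then show "V (n + i) \<in> ?B i"
          using *(1)[rule_format, of "n + i"] by auto
      qed
      ultimately show ?thesis
        by (simp add: space_PiM PiE_def Pi_def Int_def conj_commute Ball_def)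
    qed
    then have "emeasure ?Q (?E {v}) = (\<Prod>i\<in>?J. emeasure unif (?B (i - n)))"
      using B by (simp add: emeasure_PiM)
    also have "\<dots> = (\<Prod>i<m. emeasure unif (?B i))"
      by (rule prod.reindex_bij_witness[of _ "\<lambda>i. n + i" "\<lambda>i. i - n"]) auto
    also have "\<dots> = (\<Prod>i<m. ennreal (pmf (PU n U) (v i)))"
      using v by (intro prod.cong refl emeasure_unif_rank U) (auto simp: conf_p_range_def)
    also have "\<dots> = ennreal (pmf ?p v)"
      using v by (subst pmf_Pi') (auto simp: conf_p_range_def prod_ennreal PiE_def extensional_def)
    finally show ?thesis .
  qed
  have "set_pmf ?p \<subseteq> ?R"
    using set_pmf_PU[OF U]
    by (auto simp: set_Pi_pmf PiE_dflt_def conf_p_range_def PiE_iff extensional_def)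
  \<comment> \<open>The part of \<open>A\<close> outside the finite range carries no mass, which
    leaves a finite sum.\<close>
  then have "measure_pmf.prob ?p A = measure_pmf.prob ?p (A \<inter> ?R)"
    by (intro measure_prob_cong_0) (auto simp: set_pmf_iff)
  also have "\<dots> = (\<Sum>v\<in>A \<inter> ?R. pmf ?p v)"
    by (rule measure_measure_pmf_finite) simp
  finally have "ennreal (measure_pmf.prob ?p A) = (\<Sum>v\<in>A \<inter> ?R. ennreal (pmf ?p v))"
    by (simp add: sum_ennreal)
  also have "\<dots> = (\<Sum>v\<in>A \<inter> ?R. emeasure ?Q (?E {v}))"
    by (intro sum.cong refl single[symmetric]) simp
  also have "\<dots> = emeasure ?Q (\<Union>v\<in>A \<inter> ?R. ?E {v})"
  proof (rule sum_emeasure)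
    show "(\<lambda>v. ?E {v}) ` (A \<inter> ?R) \<subseteq> sets ?Q" using E by blast
  qed (auto simp: disjoint_family_on_def)
  also have "(\<Union>v\<in>A \<inter> ?R. ?E {v}) = ?E A"
    using conf_p_in_range by auto
  finally show ?thesis .
qed

text \<open>Negating the uniform variables turns the \<open>\<ge>\<close> in the p-values into the
  left-to-right cell count that defines \<open>P\<^sup>U\<close>.\<close>

lemma Pnm_prob_eq_emeasure:
  "Pnm_prob n m A = emeasure (PiM {..<n + m} (\<lambda>_. unif))
     {x\<in>space (PiM {..<n + m} (\<lambda>_. unif)). conf_p n m (\<lambda>i. - x i) \<in> A}"
proof -
  interpret product_sigma_finite "\<lambda>_::nat. unif"
    by (intro product_sigma_finite.intro prob_space_imp_sigma_finite prob_space_unif)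
  let ?I = "{..<n}" let ?J = "{n..<n + m}"
  have IJ: "{..<n + m} = ?I \<union> ?J" by auto
  define E where "E = {x\<in>space (PiM {..<n + m} (\<lambda>_. unif)). conf_p n m (\<lambda>i. - x i) \<in> A}"
  have E: "E \<in> sets (PiM (?I \<union> ?J) (\<lambda>_. unif))"
    unfolding E_def IJ[symmetric] by (intro sets_conf_p) auto
  have "emeasure (PiM {..<n + m} (\<lambda>_. unif)) E = (\<integral>\<^sup>+x. indicator E x \<partial>PiM (?I \<union> ?J) (\<lambda>_. unif))"
    unfolding IJ using E by simp
  also have "\<dots> = (\<integral>\<^sup>+U. (\<integral>\<^sup>+V. indicator E (merge ?I ?J (U, V)) \<partial>PiM ?J (\<lambda>_. unif)) \<partial>PiM ?I (\<lambda>_. unif))"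
    using E by (intro product_nn_integral_fold) auto
  also have "\<dots> = Pnm_prob n m A"
    unfolding Pnm_prob_def
  proof (rule nn_integral_cong_AE)
    \<comment> \<open>The conditional law is known only for \<open>U\<close> in
      \<open>[0,1]^n\<close>, hence the almost-everywhere equality.\<close>
    show "AE U in PiM ?I (\<lambda>_. unif). (\<integral>\<^sup>+V. indicator E (merge ?I ?J (U, V)) \<partial>PiM ?J (\<lambda>_. unif)) =
      ennreal (measure_pmf.prob (Pi_pmf {..<m} undefined (\<lambda>_. PU n U)) A)"
      using AE_PiM_unif AE_space
    proof eventually_elim
      fix U assume U: "\<forall>j<n. 0 \<le> U j \<and> U j \<le> 1" and sp: "U \<in> space (PiM ?I (\<lambda>_. unif))"
      let ?F = "{V\<in>space (PiM ?J (\<lambda>_. unif)). conf_p n m (\<lambda>i. - merge ?I ?J (U, V) i) \<in> A}"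
      have F: "?F \<in> sets (PiM ?J (\<lambda>_. unif))"
      proof (rule sets_conf_p)
        fix i assume "i < n + m"
        then show "(\<lambda>V. - merge ?I ?J (U, V) i) \<in> borel_measurable (PiM ?J (\<lambda>_. unif))"
          by (cases "i < n") (auto simp: merge_def)
      qed
      have "(\<integral>\<^sup>+V. indicator E (merge ?I ?J (U, V)) \<partial>PiM ?J (\<lambda>_. unif)) =
          (\<integral>\<^sup>+V. indicator ?F V \<partial>PiM ?J (\<lambda>_. unif))"
      proof (rule nn_integral_cong)
        fix V assume "V \<in> space (PiM ?J (\<lambda>_. unif))"
        then have "merge ?I ?J (U, V) \<in> space (PiM {..<n + m} (\<lambda>_. unif))"
          using sp measurable_space[OF measurable_merge, of "(U, V)" ?I "\<lambda>_. unif" ?J]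
          by (simp add: IJ space_pair_measure)
        then show "indicator E (merge ?I ?J (U, V)) = indicator ?F V"
          using \<open>V \<in> space _\<close> by (simp add: E_def indicator_def)
      qed
      also have "\<dots> = emeasure (PiM ?J (\<lambda>_. unif)) ?F"
        using F by simp
      finally show "(\<integral>\<^sup>+V. indicator E (merge ?I ?J (U, V)) \<partial>PiM ?J (\<lambda>_. unif)) =
          ennreal (measure_pmf.prob (Pi_pmf {..<m} undefined (\<lambda>_. PU n U)) A)"
        using Pi_pmf_PU_eq_emeasure[of n U m A] U by simp
    qed
  qed
  finally show ?thesis by (simp add: E_def)
qed

section \<open>Permutation invariance of product laws\<close>

lemma distr_PiM_permutes:
  assumes "prob_space P" "\<pi> permutes {..<N}"
  shows "distr (PiM {..<N} (\<lambda>_. P)) (PiM {..<N} (\<lambda>_. P)) (\<lambda>x. \<lambda>i\<in>{..<N}. x (\<pi> i)) = PiM {..<N} (\<lambda>_. P)"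
  using distr_PiM_reindex[of "{..<N}" "\<lambda>_. P" \<pi> "{..<N}"] assms permutes_in_image[OF assms(2)]
  by (simp add: permutes_inj_on Pi_iff)

text \<open>The negated uniform sample is an instance of \<open>prob_conf_p_exchangeable\<close>:
  permuting coordinates preserves the product measure, and ties have measure zero.\<close>

lemma Pnm_prob_eq:
  "Pnm_prob n m A = ennreal (real (conf_p_count n m A) / fact (n + m))"
proof -
  let ?Q = "PiM {..<n + m} (\<lambda>_. unif)"
  interpret prob_space ?Q by (intro prob_space_PiM prob_space_unif)
  have "prob {x\<in>space ?Q. conf_p n m (\<lambda>i. - x i) \<in> A} = real (conf_p_count n m A) / fact (n + m)"
  proof (rule prob_conf_p_exchangeable)
    fix \<pi> assume \<pi>: "\<pi> permutes {..<n + m}"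
    let ?h = "\<lambda>x. \<lambda>i\<in>{..<n + m}. x (\<pi> i)"
    let ?E = "{x\<in>space ?Q. conf_p n m (\<lambda>i. - x i) \<in> A}"
    have \<pi>': "\<pi> i < n + m \<longleftrightarrow> i < n + m" for i using permutes_in_image[OF \<pi>] by auto
    have h: "?h \<in> measurable ?Q ?Q"
      by (intro measurable_restrict measurable_component_singleton) (simp add: \<pi>')
    have E: "?E \<in> sets ?Q" by (intro sets_conf_p) auto
    have "prob ?E = measure (distr ?Q ?Q ?h) ?E"
      by (simp only: distr_PiM_permutes[OF prob_space_unif \<pi>])
    also have "\<dots> = prob (?h -` ?E \<inter> space ?Q)"
      by (rule measure_distr[OF h E])
    also have "?h -` ?E \<inter> space ?Q = {x\<in>space ?Q. conf_p n m ((\<lambda>i. - x i) \<circ> \<pi>) \<in> A}"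
    proof -
      \<comment> \<open>\<open>?h x\<close> agrees with \<open>x \<circ> \<pi>\<close> only below
        \<open>n + m\<close>, which is all that \<open>conf_p\<close> reads.\<close>
      have "conf_p n m (\<lambda>i. - ?h x i) = conf_p n m ((\<lambda>i. - x i) \<circ> \<pi>)" for x
        by (rule conf_p_cong) simp
      then show ?thesis using measurable_space[OF h] by auto
    qed
    finally show "prob {x\<in>space ?Q. conf_p n m ((\<lambda>i. - x i) \<circ> \<pi>) \<in> A} = prob ?E" ..
  next
    show "AE x in ?Q. inj_on (\<lambda>i. - x i) {..<n + m}"
      using AE_PiM_unif_inj_on by eventually_elim (auto simp: inj_on_def)
  qed auto
  then show ?thesis
    by (simp add: Pnm_prob_eq_emeasure emeasure_eq_measure)
qed

text \<open>The sample is permuted while the training component stays fixed; the product form of the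
  joint law is what makes this harmless.\<close>

lemma distr_pair_PiM_permutes:
  assumes D: "prob_space D" and P: "prob_space P" and \<pi>: "\<pi> permutes {..<N}"
  shows "distr (D \<Otimes>\<^sub>M PiM {..<N} (\<lambda>_. P)) (D \<Otimes>\<^sub>M PiM {..<N} (\<lambda>_. P))
    (\<lambda>(t, z). (t, \<lambda>i\<in>{..<N}. z (\<pi> i))) = D \<Otimes>\<^sub>M PiM {..<N} (\<lambda>_. P)"
proof -
  let ?R = "PiM {..<N} (\<lambda>_. P)"
  let ?h = "\<lambda>z. \<lambda>i\<in>{..<N}. z (\<pi> i)"
  have h: "?h \<in> measurable ?R ?R"
    using permutes_in_image[OF \<pi>]
    by (intro measurable_restrict measurable_component_singleton) auto
  have "sigma_finite_measure (distr ?R ?R ?h)"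
    unfolding distr_PiM_permutes[OF P \<pi>]
    by (intro prob_space_imp_sigma_finite prob_space_PiM P)
  from pair_measure_distr[OF measurable_ident h this]
  have "distr D D id \<Otimes>\<^sub>M distr ?R ?R ?h = distr (D \<Otimes>\<^sub>M ?R) (D \<Otimes>\<^sub>M ?R) (\<lambda>(t, z). (id t, ?h z))" .
  then show ?thesis
    by (simp add: distr_PiM_permutes[OF P \<pi>] id_def)
qed

section \<open>The conformal scores and the law of their p-values\<close>

text \<open>The scores as a function of training value and sample alone, so that the symmetry
  argument can be run on the joint law of these two.\<close>

definition sample_score ::
  "('t \<Rightarrow> (nat \<Rightarrow> 'x) \<Rightarrow> 'x \<Rightarrow> real) \<Rightarrow> nat \<Rightarrow> 't \<times> (nat \<Rightarrow> 'x \<times> real) \<Rightarrow> nat \<Rightarrow> real" where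
  "sample_score mu N = (\<lambda>(t, z) i.
     \<bar>snd (z i) - mu t (\<lambda>j\<in>{..<N}. fst (z j)) (fst (z i))\<bar>)"

lemma score_eq_sample_score:
  "i < N \<Longrightarrow> score T X Y mu N i \<omega> = sample_score mu N (T \<omega>, \<lambda>i\<in>{..<N}. (X i \<omega>, Y i \<omega>)) i"
  by (simp add: score_def mu_hat_def sample_score_def cong: restrict_cong)

lemma borel_measurable_sample_score:
  fixes mu :: "'t \<Rightarrow> (nat \<Rightarrow> 'x::euclidean_space) \<Rightarrow> 'x \<Rightarrow> real"
  assumes mu: "(\<lambda>(t, xs, x). mu t xs x)
      \<in> borel_measurable (MT \<Otimes>\<^sub>M (PiM {..<N} (\<lambda>_. borel) \<Otimes>\<^sub>M borel))"
    and i: "i < N"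
  shows "(\<lambda>k. sample_score mu N k i) \<in> borel_measurable (MT \<Otimes>\<^sub>M PiM {..<N} (\<lambda>_. borel))"
proof -
  let ?L = "MT \<Otimes>\<^sub>M PiM {..<N} (\<lambda>_. borel :: ('x \<times> real) measure)"
  have comp: "(\<lambda>k. snd k j) \<in> measurable ?L borel" if "j < N" for j
    using that by (intro measurable_compose[OF measurable_snd] measurable_component_singleton) auto
  have "fst \<in> measurable (borel :: ('x \<times> real) measure) borel"
    "snd \<in> measurable (borel :: ('x \<times> real) measure) borel"
    unfolding borel_prod[symmetric] by simp_all
  then have f: "(\<lambda>k. fst (snd k j)) \<in> borel_measurable ?L"
    and s: "(\<lambda>k. snd (snd k j)) \<in> borel_measurable ?L" if "j < N" for j
    using measurable_compose[OF comp[OF that]] by auto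
  have "(\<lambda>k. (fst k, (\<lambda>j\<in>{..<N}. fst (snd k j)), fst (snd k i)))
      \<in> measurable ?L (MT \<Otimes>\<^sub>M (PiM {..<N} (\<lambda>_. borel) \<Otimes>\<^sub>M borel))"
    using f i by (intro measurable_Pair measurable_fst measurable_restrict) auto
  from measurable_compose[OF this mu] s[OF i]
  show ?thesis
    by (auto simp: sample_score_def case_prod_unfold)
qed

text \<open>The symmetry of the predictor enters here: permuted covariates give the same fit, so
  permuting the sample merely permutes the scores.\<close>

lemma sample_score_permutes:
  assumes \<pi>: "\<pi> permutes {..<N}"
    and inv: "\<And>t xs x. mu t (xs \<circ> \<pi>) x = mu t xs x"
    and i: "i < N"
  shows "sample_score mu N (t, \<lambda>i\<in>{..<N}. z (\<pi> i)) i = sample_score mu N (t, z) (\<pi> i)"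
proof -
  \<comment> \<open>\<open>inv\<close> needs equality at all indices; from \<open>N\<close> on,
    \<open>\<pi>\<close> is the identity and both sides are \<open>undefined\<close>.\<close>
  have "(\<lambda>j\<in>{..<N}. fst ((\<lambda>i\<in>{..<N}. z (\<pi> i)) j)) = (\<lambda>j\<in>{..<N}. fst (z j)) \<circ> \<pi>"
    using permutes_in_image[OF \<pi>] by (auto simp: fun_eq_iff permutes_not_in[OF \<pi>])
  then show ?thesis
    using i by (simp add: sample_score_def inv)
qed

text \<open>Training data and sample have a product joint law, invariant under permuting the sample,
  so the scores meet \<open>exch\<close>. Their p-values then have the same rank-count probability
  as in the uniform model.\<close>

lemma measure_conf_pvals:
  fixes M :: "'w measure"
    and MT :: "'t measure" and T :: "'w \<Rightarrow> 't"
    and X :: "nat \<Rightarrow> 'w \<Rightarrow> 'x::euclidean_space" and Y :: "nat \<Rightarrow> 'w \<Rightarrow> real"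
    and P :: "('x \<times> real) measure"
    and mu :: "'t \<Rightarrow> (nat \<Rightarrow> 'x) \<Rightarrow> 'x \<Rightarrow> real"
  assumes M: "prob_space M"
    and N: "0 < n + m"
    and T: "T \<in> measurable M MT"
    and XY: "\<And>i. i < n + m \<Longrightarrow> (\<lambda>\<omega>. (X i \<omega>, Y i \<omega>)) \<in> measurable M borel"
    and indep: "prob_space.indep_vars M (\<lambda>_. borel) (\<lambda>i \<omega>. (X i \<omega>, Y i \<omega>)) {..<n + m}"
    and P: "\<And>i. i < n + m \<Longrightarrow> distr M borel (\<lambda>\<omega>. (X i \<omega>, Y i \<omega>)) = P"
    and indep_T: "prob_space.indep_set M (sets (vimage_algebra (space M) T MT))
           (sets (vimage_algebra (space M) (\<lambda>\<omega>. \<lambda>i\<in>{..<n + m}. (X i \<omega>, Y i \<omega>))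
                    (PiM {..<n + m} (\<lambda>_. borel))))"
    and mu: "(\<lambda>(t, xs, x). mu t xs x)
           \<in> borel_measurable (MT \<Otimes>\<^sub>M (PiM {..<n + m} (\<lambda>_. borel) \<Otimes>\<^sub>M borel))"
    and inv: "\<And>t xs x \<pi>. \<pi> permutes {..<n + m} \<Longrightarrow> mu t (xs \<circ> \<pi>) x = mu t xs x"
    and inj: "AE \<omega> in M. inj_on (\<lambda>i. score T X Y mu (n + m) i \<omega>) {..<n + m}"
  shows "{\<omega>\<in>space M. conf_pvals T X Y mu n m \<omega> \<in> A} \<in> sets M"
    and "ennreal (measure M {\<omega>\<in>space M. conf_pvals T X Y mu n m \<omega> \<in> A}) = Pnm_prob n m A"
proof -
  interpret prob_space M by fact
  define Z where "Z \<omega> = (\<lambda>i\<in>{..<n + m}. (X i \<omega>, Y i \<omega>))" for \<omega>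
  define S where "S \<omega> i = score T X Y mu (n + m) i \<omega>" for \<omega> i
  define D where "D = distr M MT T"
  let ?B = "PiM {..<n + m} (\<lambda>_. borel :: ('x \<times> real) measure)"
  let ?R = "PiM {..<n + m} (\<lambda>_. P)"
  let ?L = "MT \<Otimes>\<^sub>M ?B"
  let ?K = "D \<Otimes>\<^sub>M ?R"
  let ?W = "\<lambda>\<omega>. (T \<omega>, Z \<omega>)"
  have Z: "Z \<in> measurable M ?B"
    unfolding Z_def using XY by (intro measurable_restrict) auto
  have W: "?W \<in> measurable M ?L"
    using T Z by (rule measurable_Pair)
  have S_W: "S \<omega> i = sample_score mu (n + m) (?W \<omega>) i" if "i < n + m" for \<omega> i
    unfolding S_def Z_def using that by (rule score_eq_sample_score)
  have S: "(\<lambda>\<omega>. S \<omega> i) \<in> borel_measurable M" if "i < n + m" for i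
    using measurable_compose[OF W borel_measurable_sample_score[OF mu that]] by (simp add: S_W that)
  have conf: "conf_pvals T X Y mu n m \<omega> = conf_p n m (S \<omega>)" for \<omega>
    by (simp add: conf_pvals_def conf_p_def S_def)
  show "{\<omega>\<in>space M. conf_pvals T X Y mu n m \<omega> \<in> A} \<in> events"
    unfolding conf by (rule sets_conf_p[OF S])
  have psP: "prob_space P"
    using prob_space_distr[OF XY[OF N]] by (simp only: P[OF N])
  have psD: "prob_space D"
    unfolding D_def by (rule prob_space_distr[OF T])
  have setsP: "sets P = sets borel"
    unfolding P[OF N, symmetric] by (rule sets_distr)
  have "distr M ?B (\<lambda>\<omega>. \<lambda>i\<in>{..<n + m}. (X i \<omega>, Y i \<omega>))
      = (\<Pi>\<^sub>M i\<in>{..<n + m}. distr M borel (\<lambda>\<omega>. (X i \<omega>, Y i \<omega>)))"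
    using N XY indep by (subst indep_vars_iff_distr_eq_PiM'[symmetric]) auto
  also have "\<dots> = ?R"
    using P by (intro PiM_cong) auto
  finally have distr_Z: "distr M ?B Z = ?R"
    unfolding Z_def .
  have sets_K: "sets ?K = sets ?L"
    by (intro sets_pair_measure_cong sets_PiM_cong) (simp_all add: D_def setsP)
  \<comment> \<open>Independence of the training sample turns the joint law into a product;
    agreement on rectangles suffices.\<close>
  have "?K = distr M ?L ?W"
  proof (rule pair_measure_eqI)
    show "sigma_finite_measure D" by (rule prob_space_imp_sigma_finite[OF psD])
    show "sigma_finite_measure ?R" by (intro prob_space_imp_sigma_finite prob_space_PiM psP)
    show "sets ?K = sets (distr M ?L ?W)" using sets_K by simp
    fix A B assume "A \<in> sets D" "B \<in> sets ?R"
    then have A: "A \<in> sets MT" and B: "B \<in> sets ?B"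
      by (simp_all add: D_def flip: distr_Z)
    have "prob ((T -` A \<inter> space M) \<inter> (Z -` B \<inter> space M)) =
        prob (T -` A \<inter> space M) * prob (Z -` B \<inter> space M)"
      using A B by (intro indep_setD[OF indep_T[folded Z_def]] in_vimage_algebra)
    moreover have "?W -` (A \<times> B) \<inter> space M = (T -` A \<inter> space M) \<inter> (Z -` B \<inter> space M)"
      by auto
    ultimately have "emeasure (distr M ?L ?W) (A \<times> B) =
        emeasure M (T -` A \<inter> space M) * emeasure M (Z -` B \<inter> space M)"
      using A B by (simp add: emeasure_distr[OF W] emeasure_eq_measure ennreal_mult)
    also have "\<dots> = emeasure D A * emeasure ?R B"
      using A B by (simp add: D_def emeasure_distr[OF T] emeasure_distr[OF Z] flip: distr_Z)
    finally show "emeasure D A * emeasure ?R B = emeasure (distr M ?L ?W) (A \<times> B)" ..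
  qed
  note distr_W = this[symmetric]
  have space_K: "space ?K = space ?L"
    using sets_K by (rule sets_eq_imp_space_eq)
  have "prob {\<omega>\<in>space M. conf_p n m (S \<omega>) \<in> A} = real (conf_p_count n m A) / fact (n + m)"
  proof (rule prob_conf_p_exchangeable[OF S])
    fix \<pi> assume \<pi>: "\<pi> permutes {..<n + m}"
    have \<pi>': "\<pi> i < n + m \<longleftrightarrow> i < n + m" for i using permutes_in_image[OF \<pi>] by auto
    define g :: "'t \<times> (nat \<Rightarrow> 'x \<times> real) \<Rightarrow> 't \<times> (nat \<Rightarrow> 'x \<times> real)"
      where "g = (\<lambda>(t, z). (t, \<lambda>i\<in>{..<n + m}. z (\<pi> i)))"
    let ?E = "{k\<in>space ?L. conf_p n m (sample_score mu (n + m) k) \<in> A}"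
    have E: "?E \<in> sets ?L"
      by (intro sets_conf_p borel_measurable_sample_score[OF mu])
    have g: "g \<in> measurable ?L ?L"
      unfolding g_def case_prod_unfold
      by (intro measurable_Pair measurable_fst measurable_restrict
          measurable_compose[OF measurable_snd] measurable_component_singleton) (simp add: \<pi>')
    have gK: "g \<in> measurable ?K ?K"
      using g by (simp add: measurable_cong_sets[OF sets_K sets_K])
    have gE: "g -` ?E \<inter> space ?L = {k\<in>space ?L. conf_p n m (sample_score mu (n + m) k \<circ> \<pi>) \<in> A}"
    proof -
      have "conf_p n m (sample_score mu (n + m) (g k)) = conf_p n m (sample_score mu (n + m) k \<circ> \<pi>)" for k
        by (rule conf_p_cong)
          (cases k, simp add: g_def sample_score_permutes[where mu = mu, OF \<pi> inv[OF \<pi>]])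
      then show ?thesis using measurable_space[OF g] by auto
    qed
    \<comment> \<open>The event is carried to the product law \<open>?K\<close>, replaced there by
      its preimage under the invariant map \<open>g\<close>, and carried back; the preimage is the
      event for the permuted scores.\<close>
    have "prob {\<omega>\<in>space M. conf_p n m (S \<omega>) \<in> A} = prob (?W -` ?E \<inter> space M)"
    proof -
      have "conf_p n m (S \<omega>) = conf_p n m (sample_score mu (n + m) (?W \<omega>))" for \<omega>
        by (rule conf_p_cong) (simp add: S_W)
      then show ?thesis
        using measurable_space[OF W] by (intro arg_cong[where f=prob]) auto
    qed
    also have "\<dots> = measure ?K ?E"
      unfolding distr_W[symmetric] by (rule measure_distr[OF W E, symmetric])
    also have "\<dots> = measure (distr ?K ?K g) ?E"
      unfolding g_def distr_pair_PiM_permutes[OF psD psP \<pi>] ..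
    also have "\<dots> = measure ?K (g -` ?E \<inter> space ?L)"
      using E by (subst measure_distr[OF gK]) (simp_all only: sets_K space_K)
    also have "\<dots> = prob (?W -` (g -` ?E \<inter> space ?L) \<inter> space M)"
      unfolding distr_W[symmetric] by (rule measure_distr[OF W measurable_sets[OF g E]])
    also have "\<dots> = prob {\<omega>\<in>space M. conf_p n m (S \<omega> \<circ> \<pi>) \<in> A}"
    proof -
      have "conf_p n m (S \<omega> \<circ> \<pi>) = conf_p n m (sample_score mu (n + m) (?W \<omega>) \<circ> \<pi>)" for \<omega>
        by (rule conf_p_cong) (simp add: S_W \<pi>')
      then show ?thesis
        unfolding gE using measurable_space[OF W] by (intro arg_cong[where f=prob]) auto
    qed
    finally show "prob {\<omega>\<in>space M. conf_p n m (S \<omega> \<circ> \<pi>) \<in> A} = prob {\<omega>\<in>space M. conf_p n m (S \<omega>) \<in> A}" ..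
  next
    show "AE \<omega> in M. inj_on (S \<omega>) {..<n + m}"
      using inj by (simp add: S_def[abs_def])
  qed
  then show "ennreal (prob {\<omega>\<in>space M. conf_pvals T X Y mu n m \<omega> \<in> A}) = Pnm_prob n m A"
    unfolding conf Pnm_prob_eq by simp
qed

section \<open>The two coverage guarantees\<close>

theorem corollary1:
  fixes M :: "'w measure"
    and MT :: "'t measure" and T :: "'w \<Rightarrow> 't"
    and X :: "nat \<Rightarrow> 'w \<Rightarrow> 'x::euclidean_space" and Y :: "nat \<Rightarrow> 'w \<Rightarrow> real"
    and P :: "('x \<times> real) measure"
    and mu :: "'t \<Rightarrow> (nat \<Rightarrow> 'x) \<Rightarrow> 'x \<Rightarrow> real"
    and n m :: nat
  assumes "prob_space M"
    and "n \<ge> 1" and "m \<ge> 1"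
    and "T \<in> measurable M MT"
    and "\<And>i. i < n + m \<Longrightarrow> (\<lambda>\<omega>. (X i \<omega>, Y i \<omega>)) \<in> measurable M borel"
    and "prob_space.indep_vars M (\<lambda>_. borel) (\<lambda>i \<omega>. (X i \<omega>, Y i \<omega>)) {..<n + m}"
    and "\<And>i. i < n + m \<Longrightarrow> distr M borel (\<lambda>\<omega>. (X i \<omega>, Y i \<omega>)) = P"
    and "prob_space.indep_set M (sets (vimage_algebra (space M) T MT))
           (sets (vimage_algebra (space M) (\<lambda>\<omega>. \<lambda>i\<in>{..<n + m}. (X i \<omega>, Y i \<omega>))
                    (PiM {..<n + m} (\<lambda>_. borel))))"
    and "(\<lambda>(t, xs, x). mu t xs x)
           \<in> borel_measurable (MT \<Otimes>\<^sub>M (PiM {..<n + m} (\<lambda>_. borel) \<Otimes>\<^sub>M borel))"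
    and "\<And>t xs x \<pi>. \<pi> permutes {..<n + m} \<Longrightarrow> mu t (xs \<circ> \<pi>) x = mu t xs x"
    and "AE \<omega> in M. inj_on (\<lambda>i. score T X Y mu (n + m) i \<omega>) {..<n + m}"
  shows
    "(\<forall>\<alpha>bar \<delta> t. 0 \<le> \<alpha>bar \<and> \<alpha>bar \<le> 1 \<and> 0 < \<delta> \<and> \<delta> < 1 \<and>
        Pnm_prob n m {p. p_ord m p (nat \<lfloor>\<alpha>bar * real m\<rfloor> + 1) \<le> ereal t} \<le> ennreal \<delta>
      \<longrightarrow> measure M {\<omega>\<in>space M. FCP T X Y mu n m t \<omega> \<le> \<alpha>bar} \<ge> 1 - \<delta>)
   \<and> (\<forall>\<delta> (FCPbar :: real \<Rightarrow> (nat \<Rightarrow> real) \<Rightarrow> real).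
        0 < \<delta> \<and> \<delta> < 1 \<and>
        (\<forall>\<alpha>\<in>{0<..<1}. FCPbar \<alpha> \<in> borel_measurable (PiM {..<m} (\<lambda>_. borel))) \<and>
        Pnm_prob n m {p. \<exists>\<alpha>\<in>{0<..<1}. F_hat m p \<alpha> > FCPbar \<alpha> p} \<le> ennreal \<delta>
      \<longrightarrow> measure M {\<omega>\<in>space M. \<forall>\<alpha>\<in>{0<..<1}.
              FCP T X Y mu n m \<alpha> \<omega> \<le> FCPbar \<alpha> (conf_pvals T X Y mu n m \<omega>)} \<ge> 1 - \<delta>)"
proof -
  interpret prob_space M by fact
  have N: "0 < n + m" using assms(2) by simp
  note pv = measure_conf_pvals[OF assms(1) N assms(4-11)]
  \<comment> \<open>Both claims have this shape: \<open>A\<close> is the set of bad p-value vectors,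
    and its probability under \<open>M\<close> is \<open>Pnm_prob n m A\<close>.\<close>
  have *: "1 - \<delta> \<le> prob {\<omega>\<in>space M. conf_pvals T X Y mu n m \<omega> \<notin> A}"
    if "Pnm_prob n m A \<le> ennreal \<delta>" "0 < \<delta>" for A \<delta>
  proof -
    have "prob {\<omega>\<in>space M. conf_pvals T X Y mu n m \<omega> \<in> A} \<le> \<delta>"
      using that pv(2)[of A] by (simp flip: ennreal_le_iff)
    then show ?thesis
      using prob_neg[OF pv(1)[of A]] by simp
  qed
  show ?thesis
  proof (intro conjI allI impI; elim conjE)
    fix \<alpha>bar \<delta> t :: real
    assume "0 \<le> \<alpha>bar" "\<alpha>bar \<le> 1" "0 < \<delta>"
      "Pnm_prob n m {p. p_ord m p (nat \<lfloor>\<alpha>bar * real m\<rfloor> + 1) \<le> ereal t} \<le> ennreal \<delta>"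
    then show "1 - \<delta> \<le> prob {\<omega>\<in>space M. FCP T X Y mu n m t \<omega> \<le> \<alpha>bar}"
      using *[of "{p. p_ord m p (nat \<lfloor>\<alpha>bar * real m\<rfloor> + 1) \<le> ereal t}" \<delta>] assms(3)
      by (simp add: FCP_eq_F_hat p_ord_le_iff[simplified])
  next
    \<comment> \<open>The failure at some \<alpha> is still determined by the p-value vector, so the
      simultaneous claim is again a single event of the form above.\<close>
    fix \<delta> :: real and FCPbar :: "real \<Rightarrow> (nat \<Rightarrow> real) \<Rightarrow> real"
    assume "0 < \<delta>" "Pnm_prob n m {p. \<exists>\<alpha>\<in>{0<..<1}. F_hat m p \<alpha> > FCPbar \<alpha> p} \<le> ennreal \<delta>"
    then show "1 - \<delta> \<le> prob {\<omega>\<in>space M. \<forall>\<alpha>\<in>{0<..<1}.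
        FCP T X Y mu n m \<alpha> \<omega> \<le> FCPbar \<alpha> (conf_pvals T X Y mu n m \<omega>)}"
      using *[of "{p. \<exists>\<alpha>\<in>{0<..<1}. F_hat m p \<alpha> > FCPbar \<alpha> p}" \<delta>]
      by (simp add: FCP_eq_F_hat not_less)
  qed
qed

end
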